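(* Let $A,Q\in\mathbb{R}^{n\times n}$ with $Q=Q^{T}\ge0$, and let $X=X^{T}\in\mathbb{R}^{n\times n}$ be a solution of the Hermitian Stein equation $X=A^{T}XA+Q$. Then $\ker X$ is $A$-invariant and is contained in the null-space of $Q$. *)

theory Defs
  imports "HOL-Analysis.Analysis"
begin

definition null_space :: "real ^ 'n ^ 'm \<Rightarrow> (real ^ 'n) set" where
  "null_space M = {v. M *v v = 0}"

definition symmetric_matrix :: "real ^ 'n ^ 'n \<Rightarrow> bool" where
  "symmetric_matrix M \<longleftrightarrow> transpose M = M"

text \<open>Symmetry is not part of the following definition; it has to be assumed separately.\<close>

definition pos_semidef :: "real ^ 'n ^ 'n \<Rightarrow> bool" where
  "pos_semidef M \<longleftrightarrow> (\<forall>v. 0 \<le> v \<bullet> (M *v v))"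

definition invariant_under :: "real ^ 'n ^ 'n \<Rightarrow> (real ^ 'n) set \<Rightarrow> bool" where
  "invariant_under M V \<longleftrightarrow> (*v) M ` V \<subseteq> V"

end

theory Submission
  imports Defs
begin

text \<open>
  Let \<open>N\<close> be a subspace of maximal dimension on which the quadratic form of \<open>X\<close> is negative
  definite. Since \<open>(Ax)\<^sup>T X (Ax) = x\<^sup>T X x - x\<^sup>T Q x\<close>, the map \<open>A\<close> is injective on \<open>N\<close> and
  \<open>A N\<close> is again negative definite of maximal dimension. If \<open>v \<in> ker X\<close> had \<open>v\<^sup>T Q v > 0\<close>, the
  same would hold for \<open>N + span v\<close>, contradicting maximality; hence \<open>Q v = 0\<close>. Then
  \<open>A\<^sup>T X A v = 0\<close>, so \<open>A v\<close> is isotropic and \<open>X\<close>-orthogonal to \<open>A N\<close>. By maximality \<open>X\<close> is positive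
  semidefinite on the \<open>X\<close>-orthogonal complement of \<open>A N\<close>, so \<open>A v\<close> lies in the radical of that
  complement, and, as the complement and \<open>A N\<close> span the space, in \<open>ker X\<close>.
\<close>

definition neg_def_on :: "real ^ 'n ^ 'n \<Rightarrow> (real ^ 'n) set \<Rightarrow> bool" where
  "neg_def_on X S \<longleftrightarrow> (\<forall>x\<in>S. x \<noteq> 0 \<longrightarrow> x \<bullet> (X *v x) < 0)"

definition form_complement :: "real ^ 'n ^ 'n \<Rightarrow> (real ^ 'n) set \<Rightarrow> (real ^ 'n) set" where
  "form_complement X S = {y. \<forall>x\<in>S. x \<bullet> (X *v y) = 0}"

lemma symmetric_form_commute:
  assumes "symmetric_matrix X"
  shows "x \<bullet> (X *v y) = y \<bullet> (X *v x)"
  using assms unfolding symmetric_matrix_def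
  by (metis dot_lmul_matrix inner_commute transpose_matrix_vector)

lemma form_add_scaleR:
  assumes "symmetric_matrix X"
  shows "(x + c *\<^sub>R y) \<bullet> (X *v (x + c *\<^sub>R y)) =
    x \<bullet> (X *v x) + 2 * c * (x \<bullet> (X *v y)) + c\<^sup>2 * (y \<bullet> (X *v y))"
  using symmetric_form_commute[OF assms, of y x]
  by (simp add: matrix_vector_right_distrib matrix_vector_mult_scaleR inner_add_left
      inner_add_right power2_eq_square algebra_simps)

lemma subspace_form_complement: "subspace (form_complement X S)"
  unfolding form_complement_def subspace_def
  by (auto simp: matrix_vector_right_distrib matrix_vector_mult_scaleR inner_add_right)

text \<open>Along the line through \<open>y\<close> in direction \<open>u\<close> the form is affine
  in the parameter, as \<open>u\<close> is isotropic; being bounded below, it has slope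
  zero.\<close>

lemma isotropic_in_radical:
  assumes X: "symmetric_matrix X" and S: "subspace S"
    and nonneg: "\<And>x. x \<in> S \<Longrightarrow> 0 \<le> x \<bullet> (X *v x)"
    and u: "u \<in> S" "u \<bullet> (X *v u) = 0" and y: "y \<in> S"
  shows "y \<bullet> (X *v u) = 0"
proof (rule ccontr)
  let ?b = "y \<bullet> (X *v u)" and ?c = "y \<bullet> (X *v y)"
  assume b: "?b \<noteq> 0"
  \<comment> \<open>The solution of \<open>?c + 2 * t * ?b = -1\<close>.\<close>
  define t where "t = - (?c + 1) / (2 * ?b)"
  have "y + t *\<^sub>R u \<in> S"
    using S u y by (simp add: subspace_add subspace_scale)
  then have "0 \<le> (y + t *\<^sub>R u) \<bullet> (X *v (y + t *\<^sub>R u))"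
    by (rule nonneg)
  also have "\<dots> = ?c + 2 * t * ?b"
    using form_add_scaleR[OF X, of y t u] u by simp
  also have "\<dots> = -1"
    using b by (simp add: t_def field_simps)
  finally show False by simp
qed

lemma neg_def_on_inj:
  assumes S: "subspace S" and "neg_def_on X S"
  shows "inj_on ((*v) X) S"
proof (rule inj_onI)
  fix x y assume xy: "x \<in> S" "y \<in> S" "X *v x = X *v y"
  then have "X *v (x - y) = 0" "x - y \<in> S"
    using S by (auto simp: matrix_vector_mult_diff_distrib subspace_diff)
  then show "x = y"
    using assms(2) unfolding neg_def_on_def by force
qed

text \<open>The device for contradicting maximality, applied both to \<open>X\<close> and to the
  pulled-back form \<open>transpose A ** X ** A\<close>.\<close>

lemma neg_def_on_span_insert:
  assumes S: "subspace S" and v: "v \<notin> S"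
    and neg: "\<And>x c. x \<in> S \<Longrightarrow> x + c *\<^sub>R v \<noteq> 0 \<Longrightarrow> (x + c *\<^sub>R v) \<bullet> (X *v (x + c *\<^sub>R v)) < 0"
  shows "neg_def_on X (span (insert v S))" and "dim (span (insert v S)) = dim S + 1"
proof -
  have sp: "span S = S" using S by simp
  show "neg_def_on X (span (insert v S))"
    unfolding neg_def_on_def
  proof (intro ballI impI)
    fix z assume z: "z \<in> span (insert v S)" "z \<noteq> 0"
    then obtain c where "z - c *\<^sub>R v \<in> S" using sp by (auto simp: span_breakdown_eq)
    then show "z \<bullet> (X *v z) < 0"
      using neg[of "z - c *\<^sub>R v" c] z by simp
  qed
  show "dim (span (insert v S)) = dim S + 1"
    using v sp by (simp add: dim_insert del: span_eq_iff)
qed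

lemma maximal_neg_def_exists:
  fixes X :: "real ^ 'n ^ 'n"
  obtains N where "subspace N" "neg_def_on X N"
    "\<And>S. subspace S \<Longrightarrow> neg_def_on X S \<Longrightarrow> dim S \<le> dim N"
proof -
  let ?P = "\<lambda>S. subspace S \<and> neg_def_on X S"
  have "?P {0}" by (simp add: neg_def_on_def)
  moreover have "\<forall>S. ?P S \<longrightarrow> dim S < Suc (DIM(real ^ 'n))"
    using dim_subset_UNIV le_imp_less_Suc by blast
  ultimately show ?thesis
    using ex_has_greatest_nat[of ?P "{0}" dim] that by blast
qed

text \<open>A dimension count: \<open>X\<close> is injective on \<open>M\<close>, so the complement
  has codimension \<open>dim M\<close>, and it meets \<open>M\<close> only in 0 because a common
  vector would be isotropic.\<close>

lemma neg_def_on_decomposition: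
  fixes X :: "real ^ 'n ^ 'n"
  assumes X: "symmetric_matrix X" and M: "subspace M" "neg_def_on X M"
  obtains m y where "m \<in> M" "y \<in> form_complement X M" "w = m + y"
proof -
  let ?C = "form_complement X M"
  \<comment> \<open>By symmetry of \<open>X\<close>, this is the Euclidean orthogonal complement of
    the image of \<open>M\<close> under \<open>X\<close>.\<close>
  have C: "?C = {y \<in> UNIV. \<forall>x\<in>(*v) X ` M. orthogonal x y}"
    unfolding form_complement_def orthogonal_def
    by (auto simp: inner_commute symmetric_form_commute[OF X, of _ x for x])
  have "dim ((*v) X ` M) = dim M"
    using neg_def_on_inj[OF M] M(1)[folded span_eq_iff] by (intro dim_image_eq) (simp_all del: span_eq_iff)
  moreover have "dim ?C + dim ((*v) X ` M) = DIM(real ^ 'n)"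
    unfolding C using M
    by (subst dim_subspace_orthogonal_to_vectors)
      (auto intro: linear_subspace_image simp: dim_UNIV)
  moreover have "M \<inter> ?C = {0}"
    using M subspace_0[OF subspace_form_complement] subspace_0[of M]
    unfolding neg_def_on_def form_complement_def by force
  ultimately have "dim {x + y |x y. x \<in> M \<and> y \<in> ?C} = DIM(real ^ 'n)"
    using dim_sums_Int[OF M(1) subspace_form_complement[of X M]] by simp
  then have "span {x + y |x y. x \<in> M \<and> y \<in> ?C} = UNIV"
    by (simp only: dim_eq_full)
  then have "{x + y |x y. x \<in> M \<and> y \<in> ?C} = UNIV"
    unfolding span_eq_iff[THEN iffD2, OF subspace_sums[OF M(1) subspace_form_complement]] .
  then show ?thesis using that by blast
qed

text \<open>A vector of negative value in the complement could be adjoined to \<open>M\<close>: the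
  cross terms vanish, so the enlarged space would stay negative definite.\<close>

lemma maximal_neg_def_complement_nonneg:
  assumes X: "symmetric_matrix X" and M: "subspace M" "neg_def_on X M"
    and max: "\<And>S. subspace S \<Longrightarrow> neg_def_on X S \<Longrightarrow> dim S \<le> dim M"
    and y: "y \<in> form_complement X M"
  shows "0 \<le> y \<bullet> (X *v y)"
proof (rule ccontr)
  assume neg: "\<not> 0 \<le> y \<bullet> (X *v y)"
  have "y \<notin> M" using y neg by (auto simp: form_complement_def)
  moreover have "(x + c *\<^sub>R y) \<bullet> (X *v (x + c *\<^sub>R y)) < 0"
    if "x \<in> M" "x + c *\<^sub>R y \<noteq> 0" for x c
  proof -
    have eq: "(x + c *\<^sub>R y) \<bullet> (X *v (x + c *\<^sub>R y)) = x \<bullet> (X *v x) + c\<^sup>2 * (y \<bullet> (X *v y))"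
      using form_add_scaleR[OF X] y that by (simp add: form_complement_def)
    have "c\<^sup>2 * (y \<bullet> (X *v y)) \<le> 0" "c \<noteq> 0 \<Longrightarrow> c\<^sup>2 * (y \<bullet> (X *v y)) < 0"
      using neg by (auto simp: mult_le_0_iff mult_less_0_iff)
    moreover have "x \<noteq> 0 \<Longrightarrow> x \<bullet> (X *v x) < 0"
      using M that by (auto simp: neg_def_on_def)
    ultimately show ?thesis
      unfolding eq using that by (cases "x = 0"; cases "c = 0") auto
  qed
  ultimately have "neg_def_on X (span (insert y M))" "dim (span (insert y M)) = dim M + 1"
    using neg_def_on_span_insert[OF M(1)] by blast+
  then show False using max[of "span (insert y M)"] by simp
qed

text \<open>\<open>transpose A ** X ** A\<close> is the pullback of the form along \<open>A\<close>.
  It is injective on \<open>S\<close>, hence so is its rightmost factor \<open>A\<close>.\<close>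

lemma neg_def_on_image:
  assumes S: "subspace S" and neg: "neg_def_on (transpose A ** X ** A) S"
  shows "neg_def_on X ((*v) A ` S)" and "dim ((*v) A ` S) = dim S"
proof -
  have form: "x \<bullet> ((transpose A ** X ** A) *v x) = (A *v x) \<bullet> (X *v (A *v x))" for x
    by (simp add: matrix_vector_mul_assoc[symmetric] dot_lmul_matrix[symmetric]
        flip: transpose_matrix_vector)
  show "neg_def_on X ((*v) A ` S)"
    using neg by (force simp: neg_def_on_def form)
  have "inj_on ((*v) A) S"
    using neg_def_on_inj[OF S neg]
    by (auto simp: inj_on_def matrix_vector_mul_assoc[symmetric])
  then show "dim ((*v) A ` S) = dim S"
    using S[folded span_eq_iff] by (intro dim_image_eq) (simp_all del: span_eq_iff)
qed

theorem lemma3p1: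
  fixes A Q X :: "real ^ 'n ^ 'n"
  assumes "symmetric_matrix Q" and "pos_semidef Q"
    and "symmetric_matrix X"
    and "X = transpose A ** X ** A + Q"
  shows "invariant_under A (null_space X) \<and> null_space X \<subseteq> null_space Q"
proof -
  note Q = \<open>symmetric_matrix Q\<close> and X = \<open>symmetric_matrix X\<close>
  let ?B = "transpose A ** X ** A"
  have Q_nonneg: "0 \<le> x \<bullet> (Q *v x)" for x
    using assms(2) by (simp add: pos_semidef_def)
  have stein: "X *v x = ?B *v x + Q *v x" for x
    using assms(4) by (metis matrix_vector_mult_add_rdistrib)
  have form_B: "x \<bullet> (?B *v x) = x \<bullet> (X *v x) - x \<bullet> (Q *v x)" for x
    by (simp add: stein inner_add_right)
  obtain N where N: "subspace N" "neg_def_on X N"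
    and max: "\<And>S. subspace S \<Longrightarrow> neg_def_on X S \<Longrightarrow> dim S \<le> dim N"
    using maximal_neg_def_exists[of X] by blast
  have kerQ: "Q *v v = 0" if v: "X *v v = 0" for v
  proof -
    \<comment> \<open>Isotropy suffices: \<open>Q\<close> is semidefinite on the whole space, so
      \<open>v\<close> then pairs to zero with every vector, in particular with
      \<open>Q *v v\<close>.\<close>
    have "v \<bullet> (Q *v v) = 0"
    proof (rule ccontr)
      assume "v \<bullet> (Q *v v) \<noteq> 0"
      then have pos: "v \<bullet> (Q *v v) > 0" using Q_nonneg[of v] by simp
      then have "v \<noteq> 0" by auto
      then have "v \<notin> N" using N v by (auto simp: neg_def_on_def)
      \<comment> \<open>As \<open>v\<close> lies in the kernel of \<open>X\<close>, the
        \<open>X\<close>-part is just \<open>x \<bullet> (X *v x)\<close>. For \<open>x = 0\<close>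
        the strict sign comes from \<open>Q\<close>, otherwise from \<open>N\<close>.\<close>
      moreover have "(x + c *\<^sub>R v) \<bullet> (?B *v (x + c *\<^sub>R v)) < 0"
        if x: "x \<in> N" "x + c *\<^sub>R v \<noteq> 0" for x c
      proof (cases "x = 0")
        case True
        then have "c\<^sup>2 * (v \<bullet> (Q *v v)) > 0" using x pos by simp
        then show ?thesis using True v
          by (simp add: form_B matrix_vector_mult_scaleR power2_eq_square mult.assoc)
      next
        case False
        then have "x \<bullet> (X *v x) < 0" using N x by (auto simp: neg_def_on_def)
        then show ?thesis
          using form_add_scaleR[OF X, of x c v] v Q_nonneg[of "x + c *\<^sub>R v"]
          by (simp add: form_B)
      qed
      ultimately have S: "neg_def_on ?B (span (insert v N))"
        "dim (span (insert v N)) = dim N + 1"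
        using neg_def_on_span_insert[OF N(1)] by blast+
      then show False
        using neg_def_on_image[OF subspace_span S(1)]
          max[of "(*v) A ` span (insert v N)"]
        by (simp add: linear_subspace_image)
    qed
    then have "(Q *v v) \<bullet> (Q *v v) = 0"
      using isotropic_in_radical[OF Q subspace_UNIV] Q_nonneg by blast
    then show ?thesis by simp
  qed
  have "neg_def_on ?B N"
    using N(2) Q_nonneg by (force simp: neg_def_on_def form_B intro: less_le_trans)
  note AN = neg_def_on_image[OF N(1) this]
  let ?M = "(*v) A ` N"
  have M: "subspace ?M" using N(1) by (simp add: linear_subspace_image)
  have "X *v (A *v v) = 0" if v: "X *v v = 0" for v
  proof -
    have "?B *v v = 0" using stein[of v] kerQ[OF v] v by simp
    \<comment> \<open>Used twice: \<open>x = v\<close> gives isotropy of \<open>A *v v\<close>, and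
      \<open>x\<close> in \<open>N\<close> gives membership in the complement of
      \<open>?M\<close>.\<close>
    then have orth: "(A *v x) \<bullet> (X *v (A *v v)) = 0" for x
      by (metis dot_lmul_matrix inner_zero_right matrix_vector_mul_assoc
          transpose_matrix_vector transpose_transpose)
    have Av: "A *v v \<in> form_complement X ?M"
      using orth by (auto simp: form_complement_def)
    have rad: "y \<bullet> (X *v (A *v v)) = 0" if "y \<in> form_complement X ?M" for y
      using isotropic_in_radical[OF X subspace_form_complement _ Av orth that]
        maximal_neg_def_complement_nonneg[OF X M AN(1)] max AN(2) by simp
    \<comment> \<open>Splitting \<open>X *v (A *v v)\<close> itself makes both summands pair to zero
      with it, so its norm vanishes.\<close>
    obtain m y where "m \<in> ?M" "y \<in> form_complement X ?M" "X *v (A *v v) = m + y"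
      using neg_def_on_decomposition[OF X M AN(1)] by blast
    then have "(X *v (A *v v)) \<bullet> (X *v (A *v v)) = 0"
      using rad orth by (auto simp: inner_add_left)
    then show ?thesis by simp
  qed
  then show ?thesis
    using kerQ by (auto simp: invariant_under_def null_space_def)
qed

end
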